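(* Let $C \in M_n$. Suppose $A,B \in M_n$ are such that $W_C(A)$ and $W_C(B)$ are convex sets with empty intersection, and let $\mathcal{F} = \mathrm{conv}\{A,B\}$. If $W_C(A)\cup W_C(B)$ lies on a line, then $W_C(\mathcal{F}) = \mathrm{conv}(W_C(A)\cup W_C(B))$, and so is convex. Otherwise, there are two non-parallel lines $L_1$ and $L_2$ in $\mathbb{C}$, intersecting at a point $\mu$, such that for each $j=1,2$, $L_j$ is a common supporting line of $W_C(A)$ and $W_C(B)$ separating the two convex sets (i.e., $W_C(A)$ and $W_C(B)$ lie in opposite closed half planes determined by $L_j$), and the set $W_C(\mathcal{F})$ is star-shaped with star-center $\mu$.
   Context: $M_n$ is the set of $n\times n$ complex matrices. For $C, A \in M_n$, $W_C(A) = \{\mathrm{tr}(CU^*AU) : U \in M_n \text{ unitary}\} \subseteq \mathbb{C}$. For a non-empty $\mathcal{F}\subseteq M_n$, $W_C(\mathcal{F}) = \bigcup\{W_C(A) : A \in \mathcal{F}\}$. $\mathbb{C}$ is identified with $\mathbb{R}^2$. $\mathrm{conv}$ denotes convex hull. A set $S\subseteq\mathbb{C}$ is star-shaped with star-center $\mu\in S$ if $t\nu+(1-t)\mu\in S$ for all $\nu\in S$ and $t\in[0,1]$. A supporting line of a compact convex set $K\subseteq\mathbb{C}$ is a line meeting $K$ such that $K$ lies in one of the two closed half planes determined by the line. *)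

theory Defs
  imports "HOL-Analysis.Analysis"
begin

text \<open>
  The set \<open>M_n\<close> is the type \<^typ>\<open>complex^'n^'n\<close> with \<open>n = CARD('n)\<close>, regarded as a real vector
  space; convex hulls of matrices and of subsets of \<open>\<complex>\<close> are the real ones.
\<close>

definition conj_transpose :: "complex^'n^'m \<Rightarrow> complex^'m^'n" where
  "conj_transpose A = (\<chi> i j. cnj (A $ j $ i))"

definition unitary :: "complex^'n^'n \<Rightarrow> bool" where
  "unitary U \<longleftrightarrow> conj_transpose U ** U = mat 1 \<and> U ** conj_transpose U = mat 1"

definition C_range :: "complex^'n^'n \<Rightarrow> complex^'n^'n \<Rightarrow> complex set" where
  "C_range C A = {trace (C ** conj_transpose U ** A ** U) | U. unitary U}"

definition C_range_family :: "complex^'n^'n \<Rightarrow> (complex^'n^'n) set \<Rightarrow> complex set" where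
  "C_range_family C \<F> = (\<Union>A\<in>\<F>. C_range C A)"

definition star_center :: "complex \<Rightarrow> complex set \<Rightarrow> bool" where
  "star_center \<mu> S \<longleftrightarrow>
     \<mu> \<in> S \<and> (\<forall>\<nu>\<in>S. \<forall>t\<in>{0..1::real}. t *\<^sub>R \<nu> + (1 - t) *\<^sub>R \<mu> \<in> S)"

definition is_line :: "complex set \<Rightarrow> bool" where
  "is_line L \<longleftrightarrow> affine L \<and> aff_dim L = 1"

text \<open>
  Here \<open>\<bullet>\<close> is the Euclidean inner product of \<open>\<complex> = \<real>\<^sup>2\<close>, so \<open>(H, H')\<close> ranges over the pairs of
  opposite closed half planes with boundary line \<open>L\<close>. Negating \<open>a\<close> and \<open>b\<close> swaps \<open>H\<close> and
  \<open>H'\<close>, so the relation is symmetric in them.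
\<close>

definition opposite_half_planes :: "complex set \<Rightarrow> complex set \<Rightarrow> complex set \<Rightarrow> bool" where
  "opposite_half_planes L H H' \<longleftrightarrow>
     (\<exists>a b. a \<noteq> 0 \<and> L = {z. a \<bullet> z = b} \<and> H = {z. a \<bullet> z \<le> b} \<and> H' = {z. a \<bullet> z \<ge> b})"

definition supporting_line :: "complex set \<Rightarrow> complex set \<Rightarrow> bool" where
  "supporting_line L K \<longleftrightarrow>
     is_line L \<and> L \<inter> K \<noteq> {} \<and> (\<exists>H H'. opposite_half_planes L H H' \<and> (K \<subseteq> H \<or> K \<subseteq> H'))"

definition separating_line :: "complex set \<Rightarrow> complex set \<Rightarrow> complex set \<Rightarrow> bool" where
  "separating_line L S T \<longleftrightarrow>
     is_line L \<and> (\<exists>H H'. opposite_half_planes L H H' \<and> S \<subseteq> H \<and> T \<subseteq> H')"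

end

theory Submission
  imports Defs "HOL-Computational_Algebra.Polynomial"
begin

text \<open>
  With \<open>a(U) = tr(C U\<^sup>*AU)\<close> and \<open>b(U) = tr(C U\<^sup>*BU)\<close>, the range of the family is the union of the
  segments \<open>[a(U), b(U)]\<close>, where \<open>U\<close> runs through the compact connected unitary group. A connected
  subset of a line is convex, which settles the collinear case.

  Otherwise take the two common separating tangents as coordinate axes with origin \<open>\<mu>\<close>, so that
  \<open>W_C(A)\<close> lies in the third and \<open>W_C(B)\<close> in the first quadrant, both touching both axes. Let
  \<open>z \<in> [a(U\<^sub>0), b(U\<^sub>0)]\<close> and suppose that \<open>w\<close> strictly between \<open>\<mu>\<close> and \<open>z\<close> lies on no segment. By
  symmetry the line through \<open>a(U\<^sub>0)\<close> and \<open>b(U\<^sub>0)\<close> passes above \<open>\<mu>\<close>, hence above \<open>w\<close>, and \<open>z\<close> lies to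
  the left of the vertical axis. As \<open>W_C(A)\<close> is convex and misses \<open>w\<close>, a linear form \<open>f\<close> is smaller on it
  than at \<open>w\<close>. Passing above \<open>w\<close> while keeping \<open>f(b(U)) > f(w)\<close> is then an open and closed condition
  on \<open>U\<close>; but it fails when \<open>a(U)\<close> is the point where \<open>W_C(A)\<close> touches a suitable one of the axes.
\<close>

subsection \<open>Sweeping segments between opposite quadrants\<close>

text \<open>The first hypothesis makes both points collinear with the origin. The form with
  coefficients \<open>f1\<close>, \<open>f2\<close> is negative at one and nonnegative at the other,
  so its zero on the segment is the origin itself.\<close>

lemma origin_on_segment:
  fixes a1 a2 b1 b2 f1 f2 :: real
  assumes "a1 * b2 = a2 * b1" and "f1 * a1 + f2 * a2 < 0" and "0 \<le> f1 * b1 + f2 * b2"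
  shows "\<exists>t\<in>{0..1}. (1 - t) * a1 + t * b1 = 0 \<and> (1 - t) * a2 + t * b2 = 0"
proof -
  define \<alpha> where "\<alpha> = - (f1 * a1 + f2 * a2)"
  define \<beta> where "\<beta> = f1 * b1 + f2 * b2"
  define t where "t = \<alpha> / (\<alpha> + \<beta>)"
  have pos: "\<alpha> > 0" "\<beta> \<ge> 0" using assms by (auto simp: \<alpha>_def \<beta>_def)
  then have t: "t \<in> {0..1}" and t': "1 - t = \<beta> / (\<alpha> + \<beta>)"
    by (auto simp: t_def field_simps)
  have "\<beta> * a1 + \<alpha> * b1 = f2 * (a1 * b2 - a2 * b1)" "\<beta> * a2 + \<alpha> * b2 = f1 * (a2 * b1 - a1 * b2)"
    by (simp_all add: \<alpha>_def \<beta>_def algebra_simps)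
  then have "\<beta> * a1 + \<alpha> * b1 = 0" "\<beta> * a2 + \<alpha> * b2 = 0" using assms(1) by simp_all
  then have "(1 - t) * a1 + t * b1 = 0" "(1 - t) * a2 + t * b2 = 0"
    unfolding t' unfolding t_def by (simp_all flip: add_divide_distrib)
  with t show ?thesis by blast
qed

lemma connected_real_zero:
  fixes h :: "'a::topological_space \<Rightarrow> real"
  assumes "connected S" "continuous_on S h" "x \<in> S" "y \<in> S" "h x \<le> 0" "0 \<le> h y"
  shows "\<exists>z\<in>S. h z = 0"
proof -
  have "connected (h ` S)" by (simp add: assms connected_continuous_image)
  then have "{h x..h y} \<subseteq> h ` S" using assms by (simp add: connected_contains_Icc)
  then show ?thesis using assms by force
qed

text \<open>\<open>S\<close> stands for the unitary group, and \<open>p\<close>, \<open>q\<close>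
  for \<open>a(U)\<close>, \<open>b(U)\<close> in the coordinates given by the two tangents. The
  points \<open>y1\<close>, \<open>y2\<close>, \<open>v1\<close>, \<open>v2\<close> record contact
  with the axes. The assumptions on \<open>p\<close> and \<open>q\<close> mirror each other, so the
  symmetries of the picture yield further instances.\<close>

locale sweep =
  fixes S :: "'a::topological_space set" and p1 p2 q1 q2 :: "'a \<Rightarrow> real" and y1 y2 v1 v2 :: 'a
  assumes connected: "connected S"
    and cont: "continuous_on S p1" "continuous_on S p2" "continuous_on S q1" "continuous_on S q2"
    and closed_p: "closed ((\<lambda>x. (p1 x, p2 x)) ` S)" and convex_p: "convex ((\<lambda>x. (p1 x, p2 x)) ` S)"
    and closed_q: "closed ((\<lambda>x. (q1 x, q2 x)) ` S)" and convex_q: "convex ((\<lambda>x. (q1 x, q2 x)) ` S)"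
    and sgn: "x \<in> S \<Longrightarrow> p1 x \<le> 0" "x \<in> S \<Longrightarrow> p2 x \<le> 0" "x \<in> S \<Longrightarrow> q1 x \<ge> 0" "x \<in> S \<Longrightarrow> q2 x \<ge> 0"
    and y: "y1 \<in> S" "p1 y1 = 0" "y2 \<in> S" "p2 y2 = 0"
    and v: "v1 \<in> S" "q1 v1 = 0" "v2 \<in> S" "q2 v2 = 0"
begin

definition swept :: "real \<Rightarrow> real \<Rightarrow> bool" where
  "swept w1 w2 \<longleftrightarrow> (\<exists>x\<in>S. \<exists>t\<in>{0..1}. w1 = (1 - t) * p1 x + t * q1 x \<and> w2 = (1 - t) * p2 x + t * q2 x)"

text \<open>Cross product of \<open>p x\<close> and \<open>q x\<close>: negative iff the origin is
  strictly to the right of the directed line from \<open>p x\<close> to \<open>q x\<close>, which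
  then passes above or to the left of it.\<close>

definition cr :: "'a \<Rightarrow> real" where "cr x = p1 x * q2 x - p2 x * q1 x"

text \<open>At \<open>y1\<close> the point \<open>p\<close> is on the lower half of the vertical
  axis, at \<open>y2\<close> on the left half of the horizontal one, so \<open>cr\<close> changes
  sign and vanishes somewhere. There \<open>p\<close>, \<open>q\<close> and the origin are
  collinear, and the sum of the coordinates is a form separating the opposite quadrants.\<close>

lemma swept_zero: "swept 0 0"
proof -
  have "continuous_on S cr" unfolding cr_def by (intro continuous_intros cont)
  moreover have "cr y2 \<le> 0" "0 \<le> cr y1"
    using y sgn by (simp_all add: cr_def mult_nonpos_nonneg)
  ultimately obtain x where x: "x \<in> S" "cr x = 0"
    using connected_real_zero[OF connected _ y(3,1)] by blast
  show ?thesis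
  proof (cases "p1 x = 0 \<and> p2 x = 0")
    case True
    then show ?thesis unfolding swept_def using x(1) by (intro bexI[of _ x] bexI[of _ 0]) auto
  next
    case False
    then have "1 * p1 x + 1 * p2 x < 0" using sgn[OF x(1)] by auto
    then have "\<exists>t\<in>{0..1}. (1 - t) * p1 x + t * q1 x = 0 \<and> (1 - t) * p2 x + t * q2 x = 0"
      using x(2) sgn[OF x(1)] by (intro origin_on_segment[where ?f1.0 = 1 and ?f2.0 = 1]) (auto simp: cr_def)
    then show ?thesis unfolding swept_def using x(1) by metis
  qed
qed

text \<open>If \<open>w\<close> is missed, passing above \<open>w\<close> with \<open>q x\<close>
  beyond it in the direction of \<open>f\<close> can neither begin nor end along the connected
  \<open>S\<close>. Yet it holds at \<open>x0\<close> and fails at \<open>y1\<close> or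
  \<open>y2\<close>.\<close>

lemma swept_left_above:
  assumes x0: "x0 \<in> S" and t: "t \<in> {0..1}" and cr0: "cr x0 < 0"
    and z1: "z1 = (1 - t) * p1 x0 + t * q1 x0" and z2: "z2 = (1 - t) * p2 x0 + t * q2 x0"
    and neg: "z1 < 0" and s: "0 < s" "s < 1"
  shows "swept (s * z1) (s * z2)"
proof (rule ccontr)
  assume not_swept: "\<not> swept (s * z1) (s * z2)"
  define w1 w2 where "w1 = s * z1" and "w2 = s * z2"
  have w1: "w1 < 0" using neg s by (simp add: w1_def mult_pos_neg)
  have "(w1, w2) \<notin> (\<lambda>x. (p1 x, p2 x)) ` S"
  proof
    assume "(w1, w2) \<in> (\<lambda>x. (p1 x, p2 x)) ` S"
    then obtain x where "x \<in> S" "w1 = p1 x" "w2 = p2 x" by auto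
    then have "swept w1 w2" unfolding swept_def by (intro bexI[of _ x] bexI[of _ 0]) auto
    with not_swept show False by (simp add: w1_def w2_def)
  qed
  from separating_hyperplane_closed_point[OF convex_p closed_p this]
  obtain c d where c: "inner c (w1, w2) < d" "\<forall>k\<in>(\<lambda>x. (p1 x, p2 x)) ` S. inner c k > d"
    by (elim exE conjE) (rule that)
  \<comment> \<open>If \<open>w\<close> is above the horizontal axis, the height itself separates
    \<open>w\<close> from the values of \<open>p\<close>. Fixing this choice makes
    \<open>w2 \<le> 0\<close> available whenever \<open>f1 < 0\<close> or
    \<open>f2 \<le> 0\<close>.\<close>
  have "\<exists>f1 f2. (\<forall>x\<in>S. f1 * p1 x + f2 * p2 x < f1 * w1 + f2 * w2) \<and> (w2 > 0 \<longrightarrow> f1 = 0 \<and> f2 = 1)"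
  proof (cases "w2 > 0")
    case True
    then have "\<forall>x\<in>S. 0 * p1 x + 1 * p2 x < 0 * w1 + 1 * w2" using sgn(2) by fastforce
    then show ?thesis by blast
  next
    case False
    have "- fst c * p1 x + - snd c * p2 x < - fst c * w1 + - snd c * w2" if "x \<in> S" for x
    proof -
      have "inner c (p1 x, p2 x) > d" using c(2) that by blast
      with c(1) show ?thesis by (simp add: inner_prod_def)
    qed
    with False show ?thesis by blast
  qed
  then obtain f1 f2 where f: "\<And>x. x \<in> S \<Longrightarrow> f1 * p1 x + f2 * p2 x < f1 * w1 + f2 * w2"
    and fpos: "w2 > 0 \<Longrightarrow> f1 = 0 \<and> f2 = 1" by blast
  \<comment> \<open>\<open>g x < 0\<close> says that the line from \<open>p x\<close> to
    \<open>q x\<close> has \<open>w\<close> on its right, \<open>F x > 0\<close> that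
    \<open>q x\<close> lies beyond \<open>w\<close> for \<open>f\<close>. The maximum
    \<open>h\<close> is negative iff both hold, so one real function carries the connectedness
    argument.\<close>
  define g where "g x = (p1 x - w1) * (q2 x - w2) - (p2 x - w2) * (q1 x - w1)" for x
  define F where "F x = f1 * (q1 x - w1) + f2 * (q2 x - w2)" for x
  define h where "h x = max (g x) (- F x)" for x
  have cont_h: "continuous_on S h"
    unfolding h_def g_def F_def by (intro continuous_intros cont)

  have fy1: "f2 * p2 y1 < f1 * w1 + f2 * w2" and fy2: "f1 * p1 y2 < f1 * w1 + f2 * w2"
    using f[OF y(1)] f[OF y(3)] y by auto
  \<comment> \<open>If \<open>f2 \<le> 0 \<le> f1\<close>, then \<open>f\<close> is positive at
    \<open>w\<close>, hence at \<open>z\<close>. As the segment does not pass below the origin,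
    \<open>p x0\<close> is weakly to the right of \<open>r z\<close> at the same height, with
    \<open>r \<ge> 1\<close>. So \<open>f\<close> at \<open>p x0\<close> is at least
    \<open>r f(z) > s f(z) = f(w)\<close>, which is impossible.\<close>
  have f2_nonneg: "f2 > 0" if "f1 \<ge> 0"
  proof (rule ccontr)
    assume "\<not> f2 > 0"
    then have f2: "f2 \<le> 0" by simp
    then have "w2 \<le> 0" using fpos by fastforce
    have fw: "f1 * w1 + f2 * w2 > 0"
      using fy1 f2 sgn(2)[OF y(1)] mult_nonpos_nonpos by (meson le_less_trans)
    have "f1 * w1 \<le> 0" using that w1 by (simp add: mult_nonneg_nonpos)
    then have "f2 * w2 > 0" using fw by linarith
    then have "w2 < 0" "f2 < 0" using f2 \<open>w2 \<le> 0\<close> by (auto simp: zero_less_mult_iff)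
    then have z2': "z2 < 0" using s by (simp add: w2_def mult_less_0_iff)
    define r where "r = p2 x0 / z2"
    have r: "p2 x0 = r * z2" using z2' by (simp add: r_def)
    have "(1 - t) * p2 x0 \<le> z2" using z2 t sgn(4)[OF x0] by simp
    moreover have "p2 x0 \<le> (1 - t) * p2 x0"
      using t sgn(2)[OF x0] mult_nonneg_nonpos[of t "p2 x0"] by (simp add: algebra_simps)
    ultimately have "p2 x0 \<le> z2" by linarith
    then have r1: "r \<ge> 1" using z2' by (simp add: r_def)
    have "p1 x0 * z2 - p2 x0 * z1 = t * cr x0" by (simp add: z1 z2 cr_def algebra_simps)
    also have "\<dots> \<le> 0" using t cr0 by (simp add: mult_nonneg_nonpos)
    finally have "z2 * (p1 x0 - r * z1) \<le> 0" by (simp add: r algebra_simps)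
    then have "p1 x0 \<ge> r * z1" using z2' by (simp add: mult_le_0_iff)
    then have "f1 * (r * z1) \<le> f1 * p1 x0" using that by (rule mult_left_mono)
    then have "r * (f1 * z1 + f2 * z2) \<le> f1 * p1 x0 + f2 * p2 x0" using r by (simp add: algebra_simps)
    also have "\<dots> < s * (f1 * z1 + f2 * z2)" using f[OF x0] by (simp add: w1_def w2_def algebra_simps)
    finally have "(r - s) * (f1 * z1 + f2 * z2) < 0" by (simp add: algebra_simps)
    moreover have "s * (f1 * z1 + f2 * z2) > 0" using fw by (simp add: w1_def w2_def algebra_simps)
    ultimately show False using r1 s by (simp add: zero_less_mult_iff mult_less_0_iff)
  qed

  have no_zero: "h x \<noteq> 0" if x: "x \<in> S" for x
  proof
    assume "h x = 0"
    then consider "g x = 0" "F x \<ge> 0" | "F x = 0" "g x < 0"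
      unfolding h_def by (fastforce simp: max_def split: if_splits)
    then show False
    proof cases
      case 1
      have "\<exists>t\<in>{0..1}. (1 - t) * (p1 x - w1) + t * (q1 x - w1) = 0 \<and>
                     (1 - t) * (p2 x - w2) + t * (q2 x - w2) = 0"
        using 1 f[OF x] by (intro origin_on_segment[where ?f1.0 = f1 and ?f2.0 = f2])
          (auto simp: g_def F_def algebra_simps)
      then have "swept w1 w2" unfolding swept_def using x by (force simp: algebra_simps)
      with not_swept show False by (simp add: w1_def w2_def)
    next
      case 2
      define X Y where "X = q1 x - w1" and "Y = q2 x - w2"
      define fa where "fa = f1 * (p1 x - w1) + f2 * (p2 x - w2)"
      have fa: "fa < 0" using f[OF x] by (simp add: fa_def algebra_simps)
      have XY: "f1 * X + f2 * Y = 0" "(p1 x - w1) * Y - (p2 x - w2) * X < 0"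
        using 2 by (simp_all add: F_def g_def X_def Y_def)
      \<comment> \<open>Here \<open>q x\<close> lies on the boundary line of \<open>f\<close>
        through \<open>w\<close>. The two identities show that \<open>(X, Y)\<close> is a positive
        multiple of \<open>(- f2, f1)\<close>. As \<open>X > 0\<close>, this forces
        \<open>f2 < 0\<close>; if \<open>f1 < 0\<close>, it also forces
        \<open>Y < 0\<close>.\<close>
      have "f2 * ((p1 x - w1) * Y - (p2 x - w2) * X) = - fa * X + (p1 x - w1) * (f1 * X + f2 * Y)"
        by (simp add: fa_def algebra_simps)
      then have eX: "f2 * ((p1 x - w1) * Y - (p2 x - w2) * X) = - fa * X" using XY by simp
      have "f1 * ((p1 x - w1) * Y - (p2 x - w2) * X) = fa * Y - (p2 x - w2) * (f1 * X + f2 * Y)"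
        by (simp add: fa_def algebra_simps)
      then have eY: "f1 * ((p1 x - w1) * Y - (p2 x - w2) * X) = fa * Y" using XY by simp
      have X: "X > 0" using w1 sgn(3)[OF x] by (simp add: X_def)
      show False
      proof (cases "f1 \<ge> 0")
        case True
        have "f2 * ((p1 x - w1) * Y - (p2 x - w2) * X) < 0"
          using f2_nonneg[OF True] XY(2) by (simp add: mult_pos_neg)
        moreover have "- fa * X > 0" using fa X by (simp add: mult_neg_pos)
        ultimately show False using eX by linarith
      next
        case False
        then have "Y \<ge> 0" using fpos sgn(4)[OF x] by (force simp: Y_def)
        then have "fa * Y \<le> 0" using fa by (simp add: mult_nonpos_nonneg)
        moreover have "f1 * ((p1 x - w1) * Y - (p2 x - w2) * X) > 0"
          using False XY(2) by (simp add: mult_neg_neg)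
        ultimately show False using eY by linarith
      qed
    qed
  qed

  \<comment> \<open>The cross product of \<open>p x0 - s z\<close> and \<open>q x0 - s z\<close> is
    affine in \<open>s\<close>; it equals \<open>cr x0\<close> at \<open>s = 0\<close> and vanishes
    at \<open>s = 1\<close>, where the point is on the segment.\<close>
  have "g x0 = (1 - s) * cr x0"
    by (simp add: g_def w1_def w2_def z1 z2 cr_def algebra_simps)
  then have g0: "g x0 < 0" using s cr0 by (simp add: mult_pos_neg)
  \<comment> \<open>Otherwise \<open>f(z) < f(w) = s f(z)\<close>, so \<open>f\<close> is negative
    at \<open>z\<close> and \<open>w\<close>. The contact points then force both coefficients to be
    positive, and \<open>f\<close> is nonnegative at \<open>q x0\<close>.\<close>
  have F0: "F x0 > 0"
  proof (rule ccontr)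
    assume "\<not> F x0 > 0"
    then have b: "f1 * q1 x0 + f2 * q2 x0 \<le> f1 * w1 + f2 * w2" by (simp add: F_def algebra_simps)
    have "t \<noteq> 1" using z1 neg sgn(3)[OF x0] by auto
    then have t1: "t \<ge> 0" "1 - t > 0" using t by auto
    have "f1 * z1 + f2 * z2 = (1 - t) * (f1 * p1 x0 + f2 * p2 x0) + t * (f1 * q1 x0 + f2 * q2 x0)"
      by (simp add: z1 z2 algebra_simps)
    also have "\<dots> < (1 - t) * (f1 * w1 + f2 * w2) + t * (f1 * w1 + f2 * w2)"
      by (rule add_less_le_mono[OF mult_strict_left_mono[OF f[OF x0] t1(2)] mult_left_mono[OF b t1(1)]])
    also have "\<dots> = s * (f1 * z1 + f2 * z2)" by (simp add: w1_def w2_def algebra_simps)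
    finally have "(1 - s) * (f1 * z1 + f2 * z2) < 0" by (simp add: algebra_simps)
    then have fz: "f1 * z1 + f2 * z2 < 0" using s by (simp add: mult_less_0_iff)
    have "f1 * w1 + f2 * w2 = s * (f1 * z1 + f2 * z2)" by (simp add: w1_def w2_def algebra_simps)
    then have fw: "f1 * w1 + f2 * w2 < 0" using fz s by (simp add: mult_pos_neg)
    have "f1 > 0" "f2 > 0"
      using fy1 fy2 fw sgn(2)[OF y(1)] sgn(1)[OF y(3)] by (smt (verit) mult_nonpos_nonpos)+
    then have "f1 * q1 x0 + f2 * q2 x0 \<ge> 0" using sgn(3,4)[OF x0] by simp
    then show False using b fw by linarith
  qed
  have h0: "h x0 \<le> 0" using g0 F0 by (simp add: h_def)

  have "\<exists>y\<in>S. 0 \<le> h y"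
  proof (cases "f1 \<ge> 0")
    case True
    \<comment> \<open>At \<open>y1\<close> the point \<open>p\<close> is on the vertical axis, to
      the right of \<open>w\<close> and strictly lower. As \<open>q\<close> is weakly to the right
      of it and above it, \<open>w\<close> cannot lie to the right of the line.\<close>
    have "f2 * p2 y1 < f2 * w2" using fy1 mult_nonneg_nonpos[of f1 w1] True w1 by linarith
    then have "p2 y1 < w2" using f2_nonneg[OF True] by simp
    then have "- w1 * (q2 y1 - p2 y1) + q1 y1 * (w2 - p2 y1) \<ge> 0"
      using w1 sgn(2-4)[OF y(1)] by (intro add_nonneg_nonneg mult_nonneg_nonneg) auto
    then have "g y1 \<ge> 0" by (simp add: g_def y algebra_simps)
    then show ?thesis using y(1) by (intro bexI[of _ y1]) (simp_all add: h_def)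
  next
    case False
    \<comment> \<open>\<open>(D, E)\<close> and \<open>(X, Y)\<close> are \<open>p y2 - w\<close>
      and \<open>q y2 - w\<close>. If \<open>h y2\<close> were negative,
      \<open>f1 * (D * Y - E * X)\<close> would be a product of two negative numbers, while its
      expansion in the values of \<open>f\<close> is at most zero.\<close>
    define X Y D E where "X = q1 y2 - w1" and "Y = q2 y2 - w2" and "D = p1 y2 - w1" and "E = - w2"
    have "w2 \<le> 0" using False fpos by force
    then have pos: "X > 0" "Y \<ge> 0" "E \<ge> 0" using w1 sgn(3,4)[OF y(3)] by (auto simp: X_def Y_def E_def)
    have DE: "f1 * D + f2 * E < 0" using fy2 by (simp add: D_def E_def algebra_simps)
    show ?thesis
    proof (rule ccontr)
      assume "\<not> ?thesis"
      then have "h y2 < 0" using y(3) by force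
      then have "D * Y + w2 * X < 0" "f1 * X + f2 * Y > 0"
        by (auto simp: h_def g_def F_def X_def Y_def D_def y)
      then have gF: "D * Y - E * X < 0" "f1 * X + f2 * Y > 0" by (simp_all add: E_def)
      have "f1 * (D * Y - E * X) = Y * (f1 * D + f2 * E) - E * (f1 * X + f2 * Y)"
        by (simp add: algebra_simps)
      also have "\<dots> \<le> 0" using pos DE gF
        by (smt (verit) mult_nonneg_nonpos mult_nonneg_nonneg)
      finally show False using False gF by (simp add: mult_le_0_iff)
    qed
  qed
  then obtain y where "y \<in> S" "0 \<le> h y" by blast
  then obtain x where "x \<in> S" "h x = 0"
    using connected_real_zero[OF connected cont_h x0 _ h0] by blast
  with no_zero show False by blast
qed

end

text \<open>Reflection in the diagonal exchanges the axes and changes the sign of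
  \<open>cr\<close>.\<close>

lemma sweep_swap:
  assumes "sweep S p1 p2 q1 q2 y1 y2 v1 v2"
  shows "sweep S p2 p1 q2 q1 y2 y1 v2 v1"
proof -
  interpret sweep S p1 p2 q1 q2 y1 y2 v1 v2 by fact
  have lin: "linear (prod.swap :: real \<times> real \<Rightarrow> _)" by (auto intro!: linearI)
  have inj: "inj (prod.swap :: real \<times> real \<Rightarrow> _)" by simp
  have eq: "(\<lambda>x. (f x, g x)) ` S = prod.swap ` (\<lambda>x. (g x, f x)) ` S" for f g :: "'a \<Rightarrow> real"
    by (simp add: image_image)
  show ?thesis
    by unfold_locales
      (use cont connected sgn y v in \<open>auto simp: eq[of p2 p1] eq[of q2 q1] intro!: closed_injective_linear_image
        convex_linear_image lin inj closed_p closed_q convex_p convex_q\<close>)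
qed

text \<open>Point reflection in the origin exchanges the two quadrants, hence the roles of
  \<open>p\<close> and \<open>q\<close>. It too changes the sign of \<open>cr\<close>, so its
  composition with \<open>sweep_swap\<close> preserves that sign.\<close>

lemma sweep_reflect:
  assumes "sweep S p1 p2 q1 q2 y1 y2 v1 v2"
  shows "sweep S (\<lambda>x. - q1 x) (\<lambda>x. - q2 x) (\<lambda>x. - p1 x) (\<lambda>x. - p2 x) v1 v2 y1 y2"
proof -
  interpret sweep S p1 p2 q1 q2 y1 y2 v1 v2 by fact
  have eq: "(\<lambda>x. (- f x, - g x)) ` S = uminus ` (\<lambda>x. (f x, g x)) ` S" for f g :: "'a \<Rightarrow> real"
    by (simp add: image_image)
  show ?thesis
    by unfold_locales
      (use cont connected sgn y v in \<open>auto simp: eq closed_negations convex_negations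
        closed_p closed_q convex_p convex_q intro!: continuous_intros\<close>)
qed

section \<open>Star-shapedness in tangent coordinates\<close>

context sweep
begin

lemma swept_above:
  assumes x0: "x0 \<in> S" and t: "t \<in> {0..1}" and cr0: "cr x0 < 0"
    and z1: "z1 = (1 - t) * p1 x0 + t * q1 x0" and z2: "z2 = (1 - t) * p2 x0 + t * q2 x0"
    and s: "0 < s" "s < 1"
  shows "swept (s * z1) (s * z2)"
proof -
  have "z1 < 0 \<or> z2 > 0"
  proof (rule ccontr)
    assume "\<not> ?thesis"
    then have *: "z1 \<ge> 0" "z2 \<le> 0" by auto
    \<comment> \<open>The cross product of any point of the line with its direction is
      \<open>cr x0\<close>, which would be nonnegative in the closed fourth quadrant.\<close>
    have "z1 * (q2 x0 - p2 x0) - z2 * (q1 x0 - p1 x0) = cr x0"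
      by (simp add: z1 z2 cr_def algebra_simps)
    moreover have "z1 * (q2 x0 - p2 x0) \<ge> 0" "z2 * (q1 x0 - p1 x0) \<le> 0"
      using * sgn[OF x0] by (auto intro!: mult_nonneg_nonneg mult_nonpos_nonneg)
    ultimately show False using cr0 by linarith
  qed
  then show ?thesis
  proof
    assume "z1 < 0"
    then show ?thesis using swept_left_above[OF x0 t cr0 z1 z2 _ s] by blast
  next
    assume neg: "z2 > 0"
    \<comment> \<open>Reflection in the antidiagonal turns a point above the horizontal axis into
      one left of the vertical axis. The endpoints trade places, so \<open>t\<close> becomes
      \<open>1 - t\<close>.\<close>
    interpret r: sweep S "\<lambda>x. - q2 x" "\<lambda>x. - q1 x" "\<lambda>x. - p2 x" "\<lambda>x. - p1 x" v2 v1 y2 y1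
      by (rule sweep_swap[OF sweep_reflect[OF sweep_axioms]])
    have "r.swept (s * - z2) (s * - z1)"
    proof (rule r.swept_left_above[OF x0 _ _ _ _ _ s])
      show "1 - t \<in> {0..1}" using t by simp
      show "r.cr x0 < 0" using cr0 by (simp add: r.cr_def cr_def mult.commute)
      show "- z2 = (1 - (1 - t)) * - q2 x0 + (1 - t) * - p2 x0" unfolding z2 by simp
      show "- z1 = (1 - (1 - t)) * - q1 x0 + (1 - t) * - p1 x0" unfolding z1 by simp
      show "- z2 < 0" using neg by simp
    qed
    then obtain x u where x: "x \<in> S" "u \<in> {0..1}"
      and "s * - z2 = (1 - u) * - q2 x + u * - p2 x" "s * - z1 = (1 - u) * - q1 x + u * - p1 x"
      unfolding r.swept_def by blast
    then have "s * z1 = (1 - (1 - u)) * p1 x + (1 - u) * q1 x"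
      "s * z2 = (1 - (1 - u)) * p2 x + (1 - u) * q2 x" by simp_all
    with x show ?thesis unfolding swept_def by (intro bexI[of _ x] bexI[of _ "1 - u"]) auto
  qed
qed

text \<open>The sign of \<open>cr\<close> decides: negative is the case above, positive reduces to
  it by exchanging the axes, and for zero the segment itself contains the origin.\<close>

theorem swept_scale:
  assumes "swept z1 z2" "s \<in> {0..1}"
  shows "swept (s * z1) (s * z2)"
proof -
  obtain x t where x: "x \<in> S" "t \<in> {0..1}" and z1: "z1 = (1 - t) * p1 x + t * q1 x"
    and z2: "z2 = (1 - t) * p2 x + t * q2 x"
    using assms unfolding swept_def by blast
  consider "s = 0" | "s = 1" | "0 < s" "s < 1" using assms(2) by force
  then show ?thesis
  proof cases
    case 3
    consider "cr x < 0" | "cr x > 0" | "cr x = 0" by linarith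
    then show ?thesis
    proof cases
      case 1
      then show ?thesis using swept_above[OF x _ z1 z2 3] by blast
    next
      case 2
      interpret r: sweep S p2 p1 q2 q1 y2 y1 v2 v1
        by (rule sweep_swap[OF sweep_axioms])
      have "r.swept (s * z2) (s * z1)"
        by (rule r.swept_above[OF x _ z2 z1 3]) (use 2 in \<open>simp add: r.cr_def cr_def\<close>)
      then show ?thesis unfolding swept_def r.swept_def by blast
    next
      case zero: 3
      have "\<exists>u\<in>{0..1}. (1 - u) * p1 x + u * q1 x = 0 \<and> (1 - u) * p2 x + u * q2 x = 0"
      proof (cases "p1 x = 0 \<and> p2 x = 0")
        case True
        then show ?thesis by (intro bexI[of _ 0]) auto
      next
        case False
        then have "1 * p1 x + 1 * p2 x < 0" using sgn[OF x(1)] by auto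
        then show ?thesis
          using zero sgn[OF x(1)] by (intro origin_on_segment[where ?f1.0 = 1 and ?f2.0 = 1]) (auto simp: cr_def)
      qed
      then obtain u where u: "u \<in> {0..1}" "(1 - u) * p1 x + u * q1 x = 0" "(1 - u) * p2 x + u * q2 x = 0"
        by blast
      \<comment> \<open>The parameter \<open>u\<close> belongs to the origin and \<open>t\<close> to
        \<open>z\<close>, so the scaled point has the parameter dividing them in the same
        ratio.\<close>
      define r where "r = s * t + (1 - s) * u"
      have "s * z1 = s * z1 + (1 - s) * ((1 - u) * p1 x + u * q1 x)"
        "s * z2 = s * z2 + (1 - s) * ((1 - u) * p2 x + u * q2 x)" using u by simp_all
      then have "s * z1 = (1 - r) * p1 x + r * q1 x" "s * z2 = (1 - r) * p2 x + r * q2 x"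
        by (simp_all add: z1 z2 r_def algebra_simps)
      moreover have "r \<in> {0..1}"
        using convexD_alt[of "{0..1}" u t s] x u 3 by (simp add: r_def algebra_simps)
      ultimately show ?thesis unfolding swept_def using x(1) by blast
    qed
  qed (use assms swept_zero in auto)
qed

end

subsection \<open>The unitary group\<close>

lemma conj_transpose_nth [simp]: "conj_transpose A $ i $ j = cnj (A $ j $ i)"
  by (simp add: conj_transpose_def)

lemma conj_transpose_add: "conj_transpose (A + B) = conj_transpose A + conj_transpose B"
  by (simp add: vec_eq_iff)

lemma conj_transpose_scaleR: "conj_transpose (r *\<^sub>R A) = r *\<^sub>R conj_transpose A"
  by (simp add: vec_eq_iff)

lemma conj_transpose_mat: "conj_transpose (mat c) = mat (cnj c)"
  by (simp add: vec_eq_iff mat_def)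

lemma conj_transpose_mult: "conj_transpose (A ** B) = conj_transpose B ** conj_transpose A"
  by (simp add: vec_eq_iff matrix_matrix_mult_def mult.commute)

lemma conj_transpose_conj_transpose [simp]: "conj_transpose (conj_transpose A) = A"
  by (simp add: vec_eq_iff)

lemma matrix_add_rdistrib: "(A + B) ** C = A ** C + B ** (C :: 'a::semiring_1^'p^'n)"
  by (simp add: matrix_matrix_mult_def vec_eq_iff distrib_right sum.distrib)

lemma unitaryI: "conj_transpose U ** U = mat 1 \<Longrightarrow> unitary U"
  by (simp add: unitary_def matrix_left_right_inverse)

lemma unitary_mult: "unitary U \<Longrightarrow> unitary V \<Longrightarrow> unitary (U ** V)"
proof (rule unitaryI)
  assume "unitary U" "unitary V"
  then have "conj_transpose V ** (conj_transpose U ** U) ** V = mat 1" by (simp add: unitary_def)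
  then show "conj_transpose (U ** V) ** (U ** V) = mat 1"
    by (simp add: conj_transpose_mult matrix_mul_assoc)
qed

lemma mat_mult_nth: "(mat c ** A) $ i $ j = c * A $ i $ j"
proof -
  have "(mat c ** A) $ i $ j = (\<Sum>k\<in>UNIV. (if k = i then c * A $ k $ j else 0))"
    unfolding matrix_matrix_mult_def mat_def vec_lambda_beta by (rule sum.cong) auto
  then show ?thesis by simp
qed

lemma mat_mult_mat: "mat (c::'a::semiring_1) ** mat d = (mat (c * d) :: 'a^'n^'n)"
  by (simp add: vec_eq_iff mat_mult_nth) (simp add: mat_def)

lemma unitary_mat:
  assumes "cmod c = 1"
  shows "unitary (mat c)"
proof (rule unitaryI)
  have "cnj c * c = 1" using complex_norm_square[of c] assms by (simp add: mult.commute)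
  then show "conj_transpose (mat c) ** mat c = mat 1" by (simp add: conj_transpose_mat mat_mult_mat)
qed

section \<open>Continuity of the matrix operations\<close>

lemma continuous_on_matrix_mult [continuous_intros]:
  fixes f g :: "'a::topological_space \<Rightarrow> complex^'n^'n"
  assumes "continuous_on S f" "continuous_on S g"
  shows "continuous_on S (\<lambda>x. f x ** g x)"
  unfolding matrix_matrix_mult_def by (intro continuous_intros assms)

lemma continuous_on_conj_transpose [continuous_intros]:
  fixes f :: "'a::topological_space \<Rightarrow> complex^'n^'n"
  assumes "continuous_on S f"
  shows "continuous_on S (\<lambda>x. conj_transpose (f x))"
  unfolding conj_transpose_def by (intro continuous_intros assms)

lemma continuous_on_trace [continuous_intros]:
  fixes f :: "'a::topological_space \<Rightarrow> complex^'n^'n"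
  assumes "continuous_on S f"
  shows "continuous_on S (\<lambda>x. trace (f x))"
  unfolding trace_def by (intro continuous_intros assms)

lemma continuous_on_det [continuous_intros]:
  fixes f :: "'a::topological_space \<Rightarrow> complex^'n^'n"
  assumes "continuous_on S f"
  shows "continuous_on S (\<lambda>x. det (f x))"
  unfolding det_def by (intro continuous_intros assms)

lemma continuous_on_mat [continuous_intros]:
  fixes f :: "'a::topological_space \<Rightarrow> complex"
  assumes "continuous_on S f"
  shows "continuous_on S (\<lambda>x. mat (f x) :: complex^'n^'n)"
  unfolding mat_def
proof (intro continuous_intros)
  show "continuous_on S (\<lambda>x. if i = j then f x else 0)" for i j :: 'n
    using assms by (cases "i = j") auto
qed

lemma
  fixes A :: "complex^'n^'n"
  assumes "det A \<noteq> 0"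
  shows matrix_inv_right: "A ** matrix_inv A = mat 1" and matrix_inv_left: "matrix_inv A ** A = mat 1"
  using someI_ex[of "\<lambda>B. A ** B = mat 1 \<and> B ** A = mat 1"] assms
  by (simp_all add: matrix_inv_def invertible_det_nz[symmetric] invertible_def)

text \<open>Cramer's rule, applied to the columns of the inverse; it exhibits the entries as
  quotients of continuous functions.\<close>

lemma matrix_inv_nth:
  fixes A :: "complex^'n^'n"
  assumes "det A \<noteq> 0"
  shows "matrix_inv A $ i $ j =
    det (\<chi> k l. if l = i then mat 1 $ k $ j else A $ k $ l) / det A"
proof -
  have "A ** matrix_inv A = mat 1" using assms by (rule matrix_inv_right)
  then have "A *v (\<chi> k. matrix_inv A $ k $ j) = (\<chi> k. mat 1 $ k $ j)"
    by (simp add: vec_eq_iff matrix_matrix_mult_def matrix_vector_mult_def)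
  then have "(\<chi> k. matrix_inv A $ k $ j) =
      (\<chi> k. det (\<chi> i l. if l = k then (\<chi> k. mat 1 $ k $ j) $ i else A $ i $ l) / det A)"
    using cramer[OF assms] by blast
  then have "(\<chi> k. matrix_inv A $ k $ j) $ i =
      (\<chi> k. det (\<chi> i l. if l = k then (\<chi> k. mat 1 $ k $ j) $ i else A $ i $ l) / det A) $ i"
    by (rule arg_cong)
  then show ?thesis unfolding vec_lambda_beta .
qed

lemma continuous_on_matrix_inv:
  fixes f :: "'a::topological_space \<Rightarrow> complex^'n^'n"
  assumes f: "continuous_on S f" and det: "\<And>x. x \<in> S \<Longrightarrow> det (f x) \<noteq> 0"
  shows "continuous_on S (\<lambda>x. matrix_inv (f x))"
proof -
  have "continuous_on S (\<lambda>x. if l = i then mat 1 $ k $ j else f x $ k $ l)" for i j k l :: 'n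
    by (cases "l = i") (auto intro!: continuous_intros f)
  then have "continuous_on S (\<lambda>x. \<chi> i j.
      det (\<chi> k l. if l = i then mat 1 $ k $ j else f x $ k $ l) / det (f x))"
    by (intro continuous_intros f ballI det) auto
  moreover have "matrix_inv (f x) = (\<chi> i j.
      det (\<chi> k l. if l = i then mat 1 $ k $ j else f x $ k $ l) / det (f x))" if "x \<in> S" for x
    using det[OF that] by (simp add: vec_eq_iff matrix_inv_nth)
  ultimately show ?thesis by (simp cong: continuous_on_cong)
qed

text \<open>The determinant is a polynomial in \<open>z\<close> with value 1 at 0, hence not the
  zero polynomial.\<close>

lemma finite_det_zeros:
  fixes U :: "complex^'n^'n"
  shows "finite {z. det (mat 1 + mat z ** U) = 0}"
proof -
  define P where "P = (\<Sum>p | p permutes (UNIV::'n set). of_int (sign p) *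
    (\<Prod>i\<in>UNIV. [:mat 1 $ i $ p i, U $ i $ p i:]))"
  have P: "poly P z = det (mat 1 + mat z ** U)" for z
    by (simp add: P_def det_def poly_sum poly_prod mat_mult_nth)
  have "poly P 0 = 1" unfolding P by simp
  then have "P \<noteq> 0" by auto
  then show ?thesis using poly_roots_finite[of P] by (simp add: P)
qed

lemma infinite_unit_circle: "infinite (sphere (0::complex) 1)"
proof
  assume "finite (sphere (0::complex) 1)"
  moreover have "(1::complex) \<in> sphere 0 1" "(- 1::complex) \<in> sphere 0 1" by simp_all
  moreover have "connected (sphere (0::complex) 1)" by (intro connected_sphere) simp
  ultimately have "(1::complex) = -1"
    using connected_finite_iff_sing[of "sphere (0::complex) 1"] by (metis emptyE singletonD)
  then show False by simp
qed

text \<open>Each nonzero root \<open>z\<close> of the determinant rules out only the two phases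
  \<open>sgn z\<close> and \<open>- sgn z\<close>. There are finitely many roots but infinitely many
  phases.\<close>

lemma exists_phase_invertible:
  fixes U :: "complex^'n^'n"
  shows "\<exists>c. cmod c = 1 \<and> (\<forall>t::real. det (mat 1 + mat (t *\<^sub>R c) ** U) \<noteq> 0)"
proof -
  let ?R = "{z. det (mat 1 + mat z ** U) = 0}"
  have "finite (sgn ` ?R \<union> (\<lambda>z. - sgn z) ` ?R)" using finite_det_zeros[of U] by simp
  then have "\<not> sphere 0 1 \<subseteq> sgn ` ?R \<union> (\<lambda>z. - sgn z) ` ?R"
    using infinite_unit_circle finite_subset by metis
  then obtain c where c: "c \<in> sphere 0 1" "c \<notin> sgn ` ?R \<union> (\<lambda>z. - sgn z) ` ?R" by blast
  have "det (mat 1 + mat (t *\<^sub>R c) ** U) \<noteq> 0" for t :: real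
  proof
    assume 0: "det (mat 1 + mat (t *\<^sub>R c) ** U) = 0"
    then have "t \<noteq> 0" by auto
    have sgn: "sgn (t *\<^sub>R c) = sgn t *\<^sub>R c" using c(1) by (simp add: sgn_scaleR sgn_div_norm[of c])
    have "sgn (t *\<^sub>R c) = c \<or> - sgn (t *\<^sub>R c) = c"
      unfolding sgn using \<open>t \<noteq> 0\<close> by (cases "t > 0") auto
    moreover have "t *\<^sub>R c \<in> ?R" using 0 by blast
    ultimately show False using c(2) by (metis UnI1 UnI2 imageI)
  qed
  with c(1) show ?thesis by auto
qed

text \<open>
  The path \<open>t \<mapsto> N (N\<^sup>*)\<^sup>-\<^sup>1\<close> with \<open>N = 1 + tV\<close> normal connects \<open>1\<close> to \<open>V\<close> inside the unitary group if
  no \<open>1 + tV\<close> is singular, which multiplying \<open>V\<close> by a phase achieves.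
\<close>

lemma connected_unitary: "connected {U :: complex^'n^'n. unitary U}"
proof -
  let ?S = "{U :: complex^'n^'n. unitary U}"
  have one: "mat 1 \<in> ?S" by (simp add: unitary_mat)
  have "connected_component ?S (mat 1) U" if "unitary U" for U
  proof -
    obtain c where c: "cmod c = 1" and det: "\<And>t::real. det (mat 1 + mat (t *\<^sub>R c) ** U) \<noteq> 0"
      using exists_phase_invertible by blast
    define V where "V = mat c ** U"
    have V: "unitary V" using that c by (simp add: V_def unitary_mult unitary_mat)
    define N where "N t = mat 1 + t *\<^sub>R V" for t :: real
    have "N t = mat 1 + mat (t *\<^sub>R c) ** U" for t
      by (simp add: N_def V_def vec_eq_iff mat_mult_nth)
    then have detN: "det (N t) \<noteq> 0" for t using det by simp
    have inv: "matrix_inv (N t) ** N t = mat 1" for t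
      using detN by (rule matrix_inv_left)
    define X where "X t = N t ** conj_transpose (matrix_inv (N t))" for t
    have NX: "conj_transpose (N t) ** conj_transpose (matrix_inv (N t)) = mat 1" for t
      by (simp add: conj_transpose_mult[symmetric] inv conj_transpose_mat)
    \<comment> \<open>Since \<open>V\<close> is unitary, both products expand to the identity plus
      \<open>t\<close> times \<open>V\<close> and its adjoint plus \<open>t\<close> squared times
      the identity.\<close>
    have normal: "conj_transpose (N t) ** N t = N t ** conj_transpose (N t)" for t
      using V by (simp add: N_def unitary_def conj_transpose_add conj_transpose_scaleR
        conj_transpose_mat matrix_add_ldistrib matrix_add_rdistrib
        scalar_matrix_assoc[symmetric] matrix_scalar_ac scaleR_add_right add_ac)
    have uX: "unitary (X t)" for t
    proof (rule unitaryI)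
      have "conj_transpose (X t) ** X t =
          matrix_inv (N t) ** (conj_transpose (N t) ** N t) ** conj_transpose (matrix_inv (N t))"
        by (simp add: X_def conj_transpose_mult matrix_mul_assoc)
      also have "\<dots> = (matrix_inv (N t) ** N t) **
          (conj_transpose (N t) ** conj_transpose (matrix_inv (N t)))"
        unfolding normal by (simp add: matrix_mul_assoc)
      also have "\<dots> = mat 1" by (simp add: inv NX)
      finally show "conj_transpose (X t) ** X t = mat 1" .
    qed
    have "V ** conj_transpose (N 1) = N 1"
      using V by (simp add: N_def unitary_def conj_transpose_add
        conj_transpose_mat matrix_add_ldistrib add.commute)
    then have "X 1 = V ** (conj_transpose (N 1) ** conj_transpose (matrix_inv (N 1)))"
      by (simp add: X_def matrix_mul_assoc)
    then have X1: "X 1 = V" by (simp add: NX)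
    have "matrix_inv (mat 1 :: complex^'n^'n) = mat 1"
      using inv[of 0] by (simp add: N_def)
    then have X0: "X 0 = mat 1" by (simp add: X_def N_def conj_transpose_mat)
    have "continuous_on {0..1} X"
      unfolding X_def N_def
      by (intro continuous_intros continuous_on_matrix_inv) (use detN in \<open>auto simp: N_def\<close>)
    then have "connected (X ` {0..1})" by (intro connected_continuous_image) auto
    then have "connected_component ?S (mat 1) V"
      unfolding connected_component_def
      by (intro exI[of _ "X ` {0..1}"]) (use uX X0 X1 in \<open>force\<close>)
    \<comment> \<open>\<open>U\<close> and \<open>V\<close> differ by a phase, so the circle of all
      phases times \<open>U\<close> joins them.\<close>
    moreover have "connected_component ?S U V"
      unfolding connected_component_def
    proof (intro exI conjI)
      show "connected ((\<lambda>d. mat d ** U) ` sphere 0 1)"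
        by (intro connected_continuous_image continuous_intros connected_sphere) simp
      show "(\<lambda>d. mat d ** U) ` sphere 0 1 \<subseteq> ?S"
        using that by (auto simp: unitary_mult unitary_mat)
      show "U \<in> (\<lambda>d. mat d ** U) ` sphere 0 1" by (rule image_eqI[of _ _ 1]) auto
      show "V \<in> (\<lambda>d. mat d ** U) ` sphere 0 1" using c by (auto simp: V_def)
    qed
    ultimately show ?thesis by (meson connected_component_sym connected_component_trans)
  qed
  then show ?thesis
    unfolding connected_iff_connected_component
    by (metis connected_component_sym connected_component_trans mem_Collect_eq)
qed

lemma compact_unitary: "compact {U :: complex^'n^'n. unitary U}"
proof -
  have "norm U \<le> real CARD('n) * real CARD('n)" if U: "unitary U" for U :: "complex^'n^'n"
  proof -
    have entry: "norm (U $ i $ j) \<le> 1" for i j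
    proof -
      \<comment> \<open>This diagonal entry is the squared norm of column \<open>j\<close>, which
        bounds each entry of the column by 1.\<close>
      have "(conj_transpose U ** U) $ j $ j = 1" using U by (simp add: unitary_def mat_def)
      then have "(\<Sum>k\<in>UNIV. complex_of_real ((norm (U $ k $ j))\<^sup>2)) = 1"
        unfolding complex_norm_square by (simp add: matrix_matrix_mult_def mult.commute)
      then have "(\<Sum>k\<in>UNIV. (norm (U $ k $ j))\<^sup>2) = 1"
        by (metis of_real_eq_1_iff of_real_sum)
      moreover have "(norm (U $ i $ j))\<^sup>2 \<le> (\<Sum>k\<in>UNIV. (norm (U $ k $ j))\<^sup>2)"
        by (rule member_le_sum) auto
      ultimately show ?thesis by (simp add: power_le_one_iff abs_square_le_1)
    qed
    have row: "norm (U $ i) \<le> real CARD('n)" for i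
      using L2_set_le_sum_abs[of "\<lambda>j. norm (U $ i $ j)" UNIV] sum_mono[of UNIV "\<lambda>j. norm (U $ i $ j)" "\<lambda>_. 1"] entry
      by (simp add: norm_vec_def)
    show ?thesis
      using L2_set_le_sum_abs[of "\<lambda>i. norm (U $ i)" UNIV]
        sum_mono[of UNIV "\<lambda>i. norm (U $ i)" "\<lambda>_. real CARD('n)"] row
      by (simp add: norm_vec_def[of U])
  qed
  then have "bounded {U :: complex^'n^'n. unitary U}" by (auto intro: boundedI)
  moreover have "closed {U :: complex^'n^'n. unitary U}"
    unfolding unitary_def
    by (intro closed_Collect_conj closed_Collect_eq continuous_intros)
  ultimately show ?thesis by (simp add: compact_eq_bounded_closed)
qed

subsection \<open>Common tangents\<close>

lemma is_line_hyperplane: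
  fixes n :: complex
  assumes "n \<noteq> 0"
  shows "is_line {z. n \<bullet> z = c}"
  using assms by (simp add: is_line_def affine_hyperplane aff_dim_hyperplane)

lemma opposite_half_planes_hyperplane:
  "n \<noteq> 0 \<Longrightarrow> opposite_half_planes {z. n \<bullet> z = c} {z. n \<bullet> z \<le> c} {z. n \<bullet> z \<ge> c}"
  unfolding opposite_half_planes_def by blast

text \<open>For \<open>n\<close> nonzero this is a common supporting line in normal form, with
  \<open>S\<close> on the low side and \<open>T\<close> on the high side of the normal.\<close>

definition tangent :: "complex \<Rightarrow> real \<Rightarrow> complex set \<Rightarrow> complex set \<Rightarrow> bool" where
  "tangent n c S T \<longleftrightarrow> (\<forall>a\<in>S. n \<bullet> a \<le> c) \<and> (\<forall>b\<in>T. c \<le> n \<bullet> b) \<and>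
    (\<exists>a\<in>S. n \<bullet> a = c) \<and> (\<exists>b\<in>T. n \<bullet> b = c)"

text \<open>If \<open>n\<close> never decreases from \<open>S\<close> to \<open>T\<close>, a pair
  with equal values attains both the maximum over \<open>S\<close> and the minimum over
  \<open>T\<close>.\<close>

lemma tangentI:
  assumes "\<And>a b. a \<in> S \<Longrightarrow> b \<in> T \<Longrightarrow> 0 \<le> n \<bullet> (b - a)"
    and "a \<in> S" "b \<in> T" "n \<bullet> (b - a) = 0"
  shows "tangent n (n \<bullet> a) S T"
  unfolding tangent_def using assms by (force simp: inner_diff_right)

lemma tangent_line:
  assumes "tangent n c S T" "n \<noteq> 0"
  defines "L \<equiv> {z. n \<bullet> z = c}"
  shows "supporting_line L S" "supporting_line L T" "separating_line L S T"
proof -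
  have sub: "S \<subseteq> {z. n \<bullet> z \<le> c}" "T \<subseteq> {z. n \<bullet> z \<ge> c}" "L \<inter> S \<noteq> {}" "L \<inter> T \<noteq> {}"
    using assms by (auto simp: tangent_def)
  note line = is_line_hyperplane[OF assms(2), of c, folded L_def]
  note half = opposite_half_planes_hyperplane[OF assms(2), of c, folded L_def]
  show "supporting_line L S" "supporting_line L T" "separating_line L S T"
    unfolding supporting_line_def separating_line_def using sub line half by blast+
qed

text \<open>It vanishes iff the vectors are linearly dependent over the reals, so for nonzero
  normals it tests whether the lines are parallel.\<close>

abbreviation cross :: "complex \<Rightarrow> complex \<Rightarrow> real" where
  "cross z w \<equiv> Re z * Im w - Im z * Re w"

text \<open>
  The normals of the two tangents are read off from the extreme directions of the cone generated by
  the differences \<open>b - a\<close>, measured by their slope relative to a strictly separating direction \<open>m\<close>.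
\<close>

lemma two_tangents:
  fixes S T :: "complex set"
  assumes "compact S" "convex S" "compact T" "convex T" "S \<inter> T = {}" "S \<noteq> {}" "T \<noteq> {}"
    and no_line: "\<nexists>L. is_line L \<and> S \<union> T \<subseteq> L"
  shows "\<exists>n1 n2 c1 c2. cross n1 n2 \<noteq> 0 \<and> tangent n1 c1 S T \<and> tangent n2 c2 S T"
proof -
  obtain m k where "\<And>a. a \<in> S \<Longrightarrow> m \<bullet> a < k" "\<And>b. b \<in> T \<Longrightarrow> k < m \<bullet> b"
    using separating_hyperplane_compact_closed[of S T] assms compact_imp_closed by blast
  then have m: "0 < m \<bullet> (b - a)" if "a \<in> S" "b \<in> T" for a b
    using that by (force simp: inner_diff_right)
  define \<phi> where "\<phi> x = ((\<i> * m) \<bullet> (snd x - fst x)) / (m \<bullet> (snd x - fst x))" for x :: "complex \<times> complex"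
  have cont: "continuous_on (S \<times> T) \<phi>"
    unfolding \<phi>_def
  proof (intro continuous_intros ballI)
    fix x assume "x \<in> S \<times> T"
    then show "m \<bullet> (snd x - fst x) \<noteq> 0" using m[of "fst x" "snd x"] by auto
  qed
  have ST: "compact (S \<times> T)" "S \<times> T \<noteq> {}" using assms by (auto intro: compact_Times)
  obtain x1 where x1: "x1 \<in> S \<times> T" "\<And>y. y \<in> S \<times> T \<Longrightarrow> \<phi> x1 \<le> \<phi> y"
    using continuous_attains_inf[OF ST cont] by blast
  obtain x2 where x2: "x2 \<in> S \<times> T" "\<And>y. y \<in> S \<times> T \<Longrightarrow> \<phi> y \<le> \<phi> x2"
    using continuous_attains_sup[OF ST cont] by blast
  \<comment> \<open>\<open>\<i> * m\<close> is \<open>m\<close> turned by a right angle. On a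
    difference \<open>b - a\<close> these normals give the distance of its slope from the least,
    respectively greatest, slope, times the positive number
    \<open>m \<bullet> (b - a)\<close>.\<close>
  define n1 n2 where "n1 = \<i> * m - \<phi> x1 *\<^sub>R m" and "n2 = \<phi> x2 *\<^sub>R m - \<i> * m"
  have \<phi>: "(\<i> * m) \<bullet> (b - a) = \<phi> (a, b) * (m \<bullet> (b - a))" if "a \<in> S" "b \<in> T" for a b
    using m[OF that] by (simp add: \<phi>_def)
  have n1: "n1 \<bullet> (b - a) = (\<phi> (a, b) - \<phi> x1) * (m \<bullet> (b - a))"
    and n2: "n2 \<bullet> (b - a) = (\<phi> x2 - \<phi> (a, b)) * (m \<bullet> (b - a))" if "a \<in> S" "b \<in> T" for a b
    unfolding n1_def n2_def inner_diff_left inner_scaleR_left \<phi>[OF that] by (simp_all add: algebra_simps)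
  have t1: "tangent n1 (n1 \<bullet> fst x1) S T"
  proof (rule tangentI)
    show "0 \<le> n1 \<bullet> (b - a)" if "a \<in> S" "b \<in> T" for a b
      using n1[OF that] m[OF that] x1(2)[of "(a, b)"] that by simp
    show "n1 \<bullet> (snd x1 - fst x1) = 0" using n1[of "fst x1" "snd x1"] x1(1) by auto
  qed (use x1 in auto)
  have t2: "tangent n2 (n2 \<bullet> fst x2) S T"
  proof (rule tangentI)
    show "0 \<le> n2 \<bullet> (b - a)" if "a \<in> S" "b \<in> T" for a b
      using n2[OF that] m[OF that] x2(2)[of "(a, b)"] that by simp
    show "n2 \<bullet> (snd x2 - fst x2) = 0" using n2[of "fst x2" "snd x2"] x2(1) by auto
  qed (use x2 in auto)
  have "m \<noteq> 0" using m[of "fst x1" "snd x1"] x1(1) by auto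
  \<comment> \<open>A single slope would make \<open>n1\<close> constant on both sets together,
    placing them on one line.\<close>
  have "\<phi> x1 \<noteq> \<phi> x2"
  proof
    assume eq: "\<phi> x1 = \<phi> x2"
    have "n1 = (\<i> - of_real (\<phi> x1)) * m" by (simp add: n1_def scaleR_conv_of_real algebra_simps)
    moreover have "\<i> \<noteq> of_real (\<phi> x1)" by (metis Im_complex_of_real imaginary_unit.simps(2) zero_neq_one)
    ultimately have "n1 \<noteq> 0" using \<open>m \<noteq> 0\<close> by simp
    have flat: "n1 \<bullet> b = n1 \<bullet> a" if "a \<in> S" "b \<in> T" for a b
      using n1[OF that] x1(2)[of "(a, b)"] x2(2)[of "(a, b)"] eq that by (auto simp: inner_diff_right)
    obtain a0 b0 where "a0 \<in> S" "b0 \<in> T" using assms by blast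
    then have "S \<union> T \<subseteq> {z. n1 \<bullet> z = n1 \<bullet> a0}" using flat by (auto) (metis)
    then show False using no_line is_line_hyperplane[OF \<open>n1 \<noteq> 0\<close>] by blast
  qed
  moreover have "cross n1 n2 = (\<phi> x1 - \<phi> x2) * (m \<bullet> m)"
    by (simp add: n1_def n2_def inner_complex_def algebra_simps)
  ultimately have "cross n1 n2 \<noteq> 0" using \<open>m \<noteq> 0\<close> by simp
  with t1 t2 show ?thesis by blast
qed

lemma inner_pair_eq_iff:
  assumes "cross n1 n2 \<noteq> 0"
  shows "n1 \<bullet> z = n1 \<bullet> w \<and> n2 \<bullet> z = n2 \<bullet> w \<longleftrightarrow> z = w"
proof -
  have "z = w" if "n1 \<bullet> z = n1 \<bullet> w" "n2 \<bullet> z = n2 \<bullet> w"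
  proof -
    have 0: "n1 \<bullet> (z - w) = 0" "n2 \<bullet> (z - w) = 0" using that by (simp_all add: inner_diff_right)
    have "cross n1 n2 * Re (z - w) = Im n2 * (n1 \<bullet> (z - w)) - Im n1 * (n2 \<bullet> (z - w))"
      "cross n1 n2 * Im (z - w) = Re n1 * (n2 \<bullet> (z - w)) - Re n2 * (n1 \<bullet> (z - w))"
      by (simp_all add: inner_complex_def algebra_simps)
    then have "Re (z - w) = 0" "Im (z - w) = 0" unfolding 0 using assms by simp_all
    then show ?thesis by (simp add: complex_eq_iff)
  qed
  then show ?thesis by blast
qed

lemma hyperplanes_meet:
  assumes "cross n1 n2 \<noteq> 0"
  shows "\<exists>\<mu>. n1 \<bullet> \<mu> = c1 \<and> n2 \<bullet> \<mu> = c2"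
proof -
  define d where "d = cross n1 n2"
  define \<mu> where "\<mu> = Complex ((c1 * Im n2 - c2 * Im n1) / d) ((Re n1 * c2 - Re n2 * c1) / d)"
  have d: "d \<noteq> 0" using assms by (simp add: d_def)
  have "n1 \<bullet> \<mu> = c1 * cross n1 n2 / d" "n2 \<bullet> \<mu> = c2 * cross n1 n2 / d"
    by (simp_all add: \<mu>_def inner_complex_def add_divide_distrib[symmetric] diff_divide_distrib[symmetric] algebra_simps)
  then have "n1 \<bullet> \<mu> = c1" "n2 \<bullet> \<mu> = c2" using d by (simp_all add: d_def)
  then show ?thesis by blast
qed

text \<open>The first line has direction \<open>\<i> * n1\<close>. Were the second a translate,
  \<open>n2\<close> would be orthogonal to this direction, but their inner product is
  \<open>cross n1 n2\<close>.\<close>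

lemma not_affine_parallel:
  assumes n: "cross n1 n2 \<noteq> 0" and \<mu>: "n1 \<bullet> \<mu> = c1" "n2 \<bullet> \<mu> = c2"
  shows "\<not> affine_parallel {z. n1 \<bullet> z = c1} {z. n2 \<bullet> z = c2}"
proof
  assume "affine_parallel {z. n1 \<bullet> z = c1} {z. n2 \<bullet> z = c2}"
  then obtain a where a: "\<And>x. n1 \<bullet> x = c1 \<longleftrightarrow> n2 \<bullet> (a + x) = c2"
    unfolding affine_parallel_expl by auto
  have "n1 \<bullet> (\<mu> + \<i> * n1) = c1" using \<mu> by (simp add: inner_complex_def algebra_simps)
  then have "n2 \<bullet> (a + (\<mu> + \<i> * n1)) = n2 \<bullet> (a + \<mu>)" using a \<mu>(1) by metis
  then have "n2 \<bullet> (\<i> * n1) = 0" by (simp add: inner_add_right)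
  then show False using n by (simp add: inner_complex_def algebra_simps)
qed

subsection \<open>The range of a segment of matrices\<close>

text \<open>Keeping \<open>U\<close> as an argument allows the values for \<open>A\<close> and
  \<open>B\<close> to be paired at the same unitary matrix.\<close>

definition C_value :: "complex^'n^'n \<Rightarrow> complex^'n^'n \<Rightarrow> complex^'n^'n \<Rightarrow> complex" where
  "C_value C A U = trace (C ** conj_transpose U ** A ** U)"

lemma C_range_eq: "C_range C A = C_value C A ` {U. unitary U}"
  by (auto simp: C_range_def C_value_def)

lemma continuous_on_C_value: "continuous_on S (C_value C A)"
  unfolding C_value_def by (intro continuous_intros)

lemma compact_C_range: "compact (C_range C A)"
  unfolding C_range_eq by (intro compact_continuous_image continuous_on_C_value compact_unitary)

lemma C_range_nonempty: "C_range C A \<noteq> {}"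
  using unitary_mat[of 1] by (auto simp: C_range_eq)

lemma C_value_combination:
  "C_value C (r *\<^sub>R A + s *\<^sub>R B) U = r *\<^sub>R C_value C A U + s *\<^sub>R C_value C B U"
  by (simp add: C_value_def matrix_add_ldistrib matrix_add_rdistrib matrix_scalar_ac
      scalar_matrix_assoc[symmetric] trace_def sum.distrib scaleR_sum_right)

text \<open>For fixed \<open>U\<close> the value is real-linear in the matrix, so a segment of
  matrices is mapped onto the segment between the two end values.\<close>

lemma C_range_family_segment:
  "C_range_family C (convex hull {A, B}) =
    {(1 - t) *\<^sub>R C_value C A U + t *\<^sub>R C_value C B U | U t. unitary U \<and> t \<in> {0..1}}"
  unfolding C_range_family_def C_range_eq segment_convex_hull[symmetric] closed_segment_def
  by (force simp: C_value_combination)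

text \<open>The range of the family is a continuous image of the unitary group times the unit
  interval, hence connected. Lying on \<open>L\<close>, it is convex, and it contains both
  ranges.\<close>

lemma C_range_family_collinear:
  assumes "is_line L" "C_range C A \<union> C_range C B \<subseteq> L"
  shows "C_range_family C (convex hull {A, B}) = convex hull (C_range C A \<union> C_range C B)"
proof
  let ?W = "C_range_family C (convex hull {A, B})"
  let ?K = "C_range C A \<union> C_range C B"
  show sub: "?W \<subseteq> convex hull ?K"
  proof
    fix z assume "z \<in> ?W"
    then obtain U t where "unitary U" "t \<in> {0..1}" "z = (1 - t) *\<^sub>R C_value C A U + t *\<^sub>R C_value C B U"
      unfolding C_range_family_segment by blast
    moreover from this have "C_value C A U \<in> convex hull ?K" "C_value C B U \<in> convex hull ?K"
      by (auto simp: C_range_eq hull_inc)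
    ultimately show "z \<in> convex hull ?K" by (auto intro: convexD_alt)
  qed
  have "?W = (\<lambda>x. (1 - snd x) *\<^sub>R C_value C A (fst x) + snd x *\<^sub>R C_value C B (fst x)) `
      ({U. unitary U} \<times> {0..1})"
    unfolding C_range_family_segment by force
  moreover have "connected \<dots>"
    by (intro connected_continuous_image connected_Times connected_unitary continuous_intros
        continuous_on_compose2[OF continuous_on_C_value[of UNIV]]) auto
  ultimately have "connected ?W" by simp
  moreover have "convex hull ?K \<subseteq> L"
    using assms by (intro hull_minimal) (auto simp: is_line_def affine_imp_convex)
  then have "aff_dim ?W \<le> aff_dim L" using sub by (intro aff_dim_subset) blast
  then have "collinear ?W" using assms(1) by (simp add: is_line_def collinear_aff_dim)
  ultimately have "convex ?W" by (simp add: convex_connected_collinear)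
  moreover have "A \<in> convex hull {A, B}" "B \<in> convex hull {A, B}" by (simp_all add: hull_inc)
  then have "?K \<subseteq> ?W" unfolding C_range_family_def by blast
  ultimately show "convex hull ?K \<subseteq> ?W" by (simp add: hull_minimal)
qed

text \<open>The two normals provide affine coordinates with origin \<open>\<mu>\<close>, in which
  the tangents become the axes. In these coordinates \<open>swept_scale\<close> is the
  claim.\<close>

lemma C_range_family_star_center:
  fixes C A B :: "complex^'n^'n"
  assumes conv: "convex (C_range C A)" "convex (C_range C B)"
    and n: "cross n1 n2 \<noteq> 0"
    and t1: "tangent n1 (n1 \<bullet> \<mu>) (C_range C A) (C_range C B)"
    and t2: "tangent n2 (n2 \<bullet> \<mu>) (C_range C A) (C_range C B)"
  shows "star_center \<mu> (C_range_family C (convex hull {A, B}))"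
proof -
  let ?S = "{U :: complex^'n^'n. unitary U}"
  let ?W = "C_range_family C (convex hull {A, B})"
  define p where "p D m U = m \<bullet> C_value C D U - m \<bullet> \<mu>" for D :: "complex^'n^'n" and m U
  have im: "(\<lambda>U. (p D n1 U, p D n2 U)) ` ?S =
      (+) (- (n1 \<bullet> \<mu>, n2 \<bullet> \<mu>)) ` (\<lambda>z. (n1 \<bullet> z, n2 \<bullet> z)) ` C_range C D" for D
    by (simp add: image_image C_range_eq p_def)
  have cont: "continuous_on ?S (p D m)" for D m
    unfolding p_def by (intro continuous_intros continuous_on_C_value)
  have lin: "linear (\<lambda>z. (n1 \<bullet> z, n2 \<bullet> z))"
    by (auto intro!: linearI simp: inner_add_right)
  have convex_im: "convex ((\<lambda>U. (p D n1 U, p D n2 U)) ` ?S)" if "convex (C_range C D)" for D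
    unfolding im using that by (intro convex_translation convex_linear_image lin)
  have closed_im: "closed ((\<lambda>U. (p D n1 U, p D n2 U)) ` ?S)" for D
    by (intro compact_imp_closed compact_continuous_image continuous_intros cont compact_unitary)
  obtain y1 y2 v1 v2 where yv: "y1 \<in> ?S" "p A n1 y1 = 0" "y2 \<in> ?S" "p A n2 y2 = 0"
    "v1 \<in> ?S" "p B n1 v1 = 0" "v2 \<in> ?S" "p B n2 v2 = 0"
    using t1 t2 unfolding tangent_def C_range_eq p_def by auto
  interpret sweep ?S "p A n1" "p A n2" "p B n1" "p B n2" y1 y2 v1 v2
  proof
    show "p A n1 x \<le> 0" "p A n2 x \<le> 0" "0 \<le> p B n1 x" "0 \<le> p B n2 x" if "x \<in> ?S" for x
      using that t1 t2 by (auto simp: tangent_def C_range_eq p_def)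
  qed (fact cont connected_unitary closed_im convex_im[OF conv(1)] convex_im[OF conv(2)] yv)+
  have comb: "(1 - t) * p A m U + t * p B m U =
      m \<bullet> ((1 - t) *\<^sub>R C_value C A U + t *\<^sub>R C_value C B U) - m \<bullet> \<mu>" for m U t
    by (simp add: p_def inner_add_right algebra_simps)
  \<comment> \<open>As the normals are independent, the two coordinates determine the point, so
    membership can be tested in coordinates.\<close>
  have swept_iff: "swept (n1 \<bullet> z - n1 \<bullet> \<mu>) (n2 \<bullet> z - n2 \<bullet> \<mu>) \<longleftrightarrow> z \<in> ?W" for z
  proof -
    have "n1 \<bullet> z - n1 \<bullet> \<mu> = n1 \<bullet> w - n1 \<bullet> \<mu> \<and> n2 \<bullet> z - n2 \<bullet> \<mu> = n2 \<bullet> w - n2 \<bullet> \<mu> \<longleftrightarrow> z = w" for w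
      using inner_pair_eq_iff[OF n, of z w] by simp
    then show ?thesis unfolding swept_def comb C_range_family_segment by blast
  qed
  show ?thesis
    unfolding star_center_def
  proof (intro conjI ballI)
    show "\<mu> \<in> ?W" using swept_zero swept_iff[of \<mu>] by simp
    fix \<nu> t assume "\<nu> \<in> ?W" and t: "t \<in> {0..1::real}"
    then have "swept (t * (n1 \<bullet> \<nu> - n1 \<bullet> \<mu>)) (t * (n2 \<bullet> \<nu> - n2 \<bullet> \<mu>))"
      using swept_iff swept_scale by blast
    then show "t *\<^sub>R \<nu> + (1 - t) *\<^sub>R \<mu> \<in> ?W"
      unfolding swept_iff[symmetric] by (simp add: inner_add_right algebra_simps)
  qed
qed

theorem theorem3p7:
  fixes C A B :: "complex^'n^'n"
    and \<F> :: "(complex^'n^'n) set"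
  assumes "convex (C_range C A)"
    and "convex (C_range C B)"
    and "C_range C A \<inter> C_range C B = {}"
    and "\<F> = convex hull {A, B}"
  shows "((\<exists>L. is_line L \<and> C_range C A \<union> C_range C B \<subseteq> L) \<longrightarrow>
            C_range_family C \<F> = convex hull (C_range C A \<union> C_range C B) \<and>
            convex (C_range_family C \<F>)) \<and>
         (\<not> (\<exists>L. is_line L \<and> C_range C A \<union> C_range C B \<subseteq> L) \<longrightarrow>
            (\<exists>L1 L2 \<mu>.
               is_line L1 \<and> is_line L2 \<and>
               \<not> affine_parallel L1 L2 \<and>
               L1 \<inter> L2 = {\<mu>} \<and>
               (\<forall>L\<in>{L1, L2}.
                  supporting_line L (C_range C A) \<and>
                  supporting_line L (C_range C B) \<and>
                  separating_line L (C_range C A) (C_range C B)) \<and>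
               star_center \<mu> (C_range_family C \<F>)))"
proof (intro conjI impI)
  assume "\<exists>L. is_line L \<and> C_range C A \<union> C_range C B \<subseteq> L"
  then show "C_range_family C \<F> = convex hull (C_range C A \<union> C_range C B)"
    using C_range_family_collinear assms(4) by blast
  then show "convex (C_range_family C \<F>)" by (simp add: convex_convex_hull)
next
  assume no_line: "\<nexists>L. is_line L \<and> C_range C A \<union> C_range C B \<subseteq> L"
  obtain n1 n2 c1 c2 where n: "cross n1 n2 \<noteq> 0"
    and t1: "tangent n1 c1 (C_range C A) (C_range C B)"
    and t2: "tangent n2 c2 (C_range C A) (C_range C B)"
    using two_tangents[OF compact_C_range assms(1) compact_C_range assms(2,3)
        C_range_nonempty C_range_nonempty no_line] by blast
  obtain \<mu> where \<mu>: "n1 \<bullet> \<mu> = c1" "n2 \<bullet> \<mu> = c2" using hyperplanes_meet[OF n] by blast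
  let ?L1 = "{z. n1 \<bullet> z = c1}" and ?L2 = "{z. n2 \<bullet> z = c2}"
  have nz: "n1 \<noteq> 0" "n2 \<noteq> 0" using n by auto
  show "\<exists>L1 L2 \<mu>. is_line L1 \<and> is_line L2 \<and> \<not> affine_parallel L1 L2 \<and> L1 \<inter> L2 = {\<mu>} \<and>
      (\<forall>L\<in>{L1, L2}. supporting_line L (C_range C A) \<and> supporting_line L (C_range C B) \<and>
        separating_line L (C_range C A) (C_range C B)) \<and>
      star_center \<mu> (C_range_family C \<F>)"
  proof (intro exI conjI ballI)
    show "is_line ?L1" "is_line ?L2" using nz by (simp_all add: is_line_hyperplane)
    show "\<not> affine_parallel ?L1 ?L2" by (rule not_affine_parallel[OF n \<mu>])
    show "?L1 \<inter> ?L2 = {\<mu>}" using inner_pair_eq_iff[OF n, of _ \<mu>] \<mu> by auto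
    show "supporting_line L (C_range C A)" "supporting_line L (C_range C B)"
      "separating_line L (C_range C A) (C_range C B)" if "L \<in> {?L1, ?L2}" for L
      using that tangent_line[OF t1 nz(1)] tangent_line[OF t2 nz(2)] by auto
    show "star_center \<mu> (C_range_family C \<F>)"
      unfolding assms(4) using C_range_family_star_center[OF assms(1,2) n] t1 t2 \<mu> by blast
  qed
qed

end
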